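(* Let $\mathbf{P}\subset\mathbb{C}$ be a compact interval or a circle, or a homeomorphic image thereof. Let $(A,B) \in C_{n,n}(\mathbf{P}) \times C_{n,m}(\mathbf{P})$ be pointwise reachable. Then, for every $v \in \mathbb{C}^{m}$ with the property that $B(\theta)v\neq 0$ for all $\theta \in \mathbf{P}$, there exists $K \in C_{m,n}(\mathbf{P})$ such that the single-input pair $(A+B K, Bv) \in C_{n,n}(\mathbf{P})\times C_n(\mathbf{P})$ is pointwise reachable.
   Context: $C_n(\mathbf{P})$ and $C_{n,m}(\mathbf{P})$ denote the spaces of continuous functions on $\mathbf{P}$ with values in $\mathbb{C}^n$, respectively $\mathbb{C}^{n\times m}$. A pair $(A,B)$ is pointwise reachable if for every $\theta\in\mathbf{P}$ the pair $(A(\theta),B(\theta))$ is reachable, i.e. $\operatorname{rank}(B(\theta),A(\theta)B(\theta),\dots,A(\theta)^{n-1}B(\theta))=n$. *)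

theory Defs
  imports "HOL-Analysis.Analysis"
begin

text \<open>Since \<open>*\<close> and \<open>^\<close> on vectors are componentwise, the power with respect to the
  matrix product \<open>**\<close> has to be defined.\<close>

primrec mat_pow :: "'a::semiring_1^'n^'n \<Rightarrow> nat \<Rightarrow> 'a^'n^'n" where
  "mat_pow A 0 = mat 1"
| "mat_pow A (Suc k) = A ** mat_pow A k"

text \<open>The block matrix \<open>(B, A B, \<dots>, A^(n-1) B)\<close>, where \<open>n = CARD('n)\<close>. Its columns are
  indexed by pairs (block, column within the block); the \<open>n\<close> blocks are indexed by the type \<open>'n\<close>,
  which the bijection \<open>to_nat_on UNIV\<close> enumerates as \<open>{..<n}\<close>.\<close>

definition reachability_matrix :: "'a::field^'n^'n \<Rightarrow> 'a^'m^'n \<Rightarrow> 'a^('n \<times> 'm)^'n" where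
  "reachability_matrix A B =
     (\<chi> i kj. (mat_pow A (to_nat_on (UNIV :: 'n set) (fst kj)) ** B) $ i $ snd kj)"

lemma columns_reachability_matrix:
  fixes A :: "'a::field^'n^'n" and B :: "'a^'m^'n"
  shows "columns (reachability_matrix A B) = (\<Union>k<CARD('n). columns (mat_pow A k ** B))"
proof -
  have col: "column kj (reachability_matrix A B) =
      column (snd kj) (mat_pow A (to_nat_on (UNIV :: 'n set) (fst kj)) ** B)" for kj
    by (simp add: column_def reachability_matrix_def vec_eq_iff)
  have "to_nat_on (UNIV :: 'n set) ` UNIV = {..<CARD('n)}"
    using to_nat_on_finite[of "UNIV :: 'n set"] by (simp add: bij_betw_def)
  then have "(\<Union>k<CARD('n). columns (mat_pow A k ** B)) =
      (\<Union>k\<in>to_nat_on (UNIV :: 'n set) ` UNIV. columns (mat_pow A k ** B))"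
    by (simp only:)
  also have "\<dots> = columns (reachability_matrix A B)"
    by (force simp: columns_def col)
  finally show ?thesis ..
qed

definition reachable :: "'a::field^'n^'n \<Rightarrow> 'a^'m^'n \<Rightarrow> bool" where
  "reachable A B \<longleftrightarrow> rank (reachability_matrix A B) = CARD('n)"

definition pointwise_reachable ::
    "'p set \<Rightarrow> ('p \<Rightarrow> complex^'n^'n) \<Rightarrow> ('p \<Rightarrow> complex^'m^'n) \<Rightarrow> bool" where
  "pointwise_reachable P A B \<longleftrightarrow> (\<forall>\<theta>\<in>P. reachable (A \<theta>) (B \<theta>))"

text \<open>A compact interval or a circle, up to homeomorphism. Intervals are nonempty, and the
  degenerate interval \<open>{a}\<close> is allowed.\<close>

definition interval_or_circle :: "complex set \<Rightarrow> bool" where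
  "interval_or_circle P \<longleftrightarrow>
     (\<exists>a b :: real. a \<le> b \<and> P homeomorphic {a..b}) \<or>
     (\<exists>(c :: complex) r. 0 < r \<and> P homeomorphic sphere c r)"

end

theory Submission
  imports Defs "HOL-Complex_Analysis.Contour_Integration"
begin

text \<open>
  Fix a vector \<open>b = B v\<close> at one parameter. A gain \<open>K\<close> is good there if \<open>(A + B K, b)\<close> is reachable,
  that is, if the determinant of the matrix with columns \<open>b, (A + B K) b, (A + B K)^2 b, \<dots>\<close> does not
  vanish. The theorem asks for a continuous choice of good gains, and it follows from three
  properties of the set of good gains.

  It is nonempty: this is Heymann's lemma (\<open>heymann\<close>). Reachability of \<open>(A, B)\<close> lets one steer from
  \<open>b\<close> along a trajectory of the control system that leaves the span of its past at every
  step until the whole space is exhausted, and the controls used along this basis define \<open>K\<close>.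

  It is path-connected (\<open>path_connected_cyclic_gains\<close>): along the complex line through two good
  gains the determinant is a polynomial that is not identically zero, so only finitely many points
  of that line are bad, and the plane without finitely many points is path-connected.

  It varies openly with the parameter, since the determinant is jointly continuous. Over
  an interval this suffices for a continuous section with prescribed end values: a good gain
  at \<open>x\<close> stays good for all parameters near \<open>x\<close>, and where two such locally constant choices meet,
  one runs through a path between them inside the fibre within so short a parameter interval
  that the path stays good (\<open>linked_if_path_connected_fibres\<close>). A circle is an interval with
  its ends glued, and prescribing the same gain at both ends makes the section close up.
\<close>

section \<open>Rank and column span over a field\<close>

lemma matrix_vector_mult_axis: "C *v axis i 1 = column i C"
  for C :: "'a::semiring_1^'n^'m"
  by (simp add: matrix_vector_mult_def column_def axis_def vec_eq_iff if_distrib cong: if_cong)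

text \<open>The rank is defined as the dimension of the row space, whereas reachability is an argument
  about columns. The two meet in right invertibility, which amounts both to linear independence of
  the rows and to the columns spanning.\<close>

lemma full_row_rank_iff_span_columns:
  fixes A :: "'a::field^'n^'m"
  shows "rank A = CARD('m) \<longleftrightarrow> vec.span (columns A) = UNIV"
proof -
  have rows: "rows A = range (\<lambda>i. row i A)"
    by (auto simp: rows_def)
  have "rank A = CARD('m) \<longleftrightarrow> (\<forall>c. (\<Sum>i\<in>UNIV. c i *s row i A) = 0 \<longrightarrow> (\<forall>i. c i = 0))"
  proof
    assume dim: "rank A = CARD('m)"
    have card_le: "card (rows A) \<le> CARD('m)"
      unfolding rows by (rule card_image_le) simp
    have fin: "finite (rows A)"
      unfolding rows by simp
    have dim_le: "vec.dim (rows A) \<le> card (rows A)"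
      using vec.dim_le_card[OF vec.span_superset fin] .
    then have card: "card (rows A) = CARD('m)"
      using dim card_le by (simp add: row_rank_def_gen)
    then have inj: "inj (\<lambda>i. row i A)"
      unfolding rows by (intro eq_card_imp_inj_on) auto
    have indep: "vec.independent (rows A)"
      by (rule vec.card_le_dim_spanning[OF vec.span_superset[of "rows A"]])
        (use dim card fin in \<open>auto simp: row_rank_def_gen vec.span_superset vec.dim_span\<close>)
    show "\<forall>c. (\<Sum>i\<in>UNIV. c i *s row i A) = 0 \<longrightarrow> (\<forall>i. c i = 0)"
    proof (intro allI impI)
      fix c i assume c: "(\<Sum>i\<in>UNIV. c i *s row i A) = 0"
      have "(\<Sum>r\<in>rows A. c (inv (\<lambda>i. row i A) r) *s r) = 0"
        unfolding rows using c by (simp add: sum.reindex[OF inj] inv_f_f[OF inj])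
      then have "c (inv (\<lambda>i. row i A) (row i A)) = 0"
        by (rule vec.independentD[OF indep fin subset_refl]) (simp add: rows)
      then show "c i = 0"
        by (simp add: inv_f_f[OF inj])
    qed
  next
    assume "\<forall>c. (\<Sum>i\<in>UNIV. c i *s row i A) = 0 \<longrightarrow> (\<forall>i. c i = 0)"
    then have "inj ((*v) (transpose A))"
      unfolding matrix_right_invertible_independent_rows[symmetric]
      by (metis matrix_left_invertible_injective right_invertible_transpose transpose_transpose)
    then have "vec.dim ((*v) (transpose A) ` cart_basis) = vec.dim (cart_basis :: ('a^'m) set)"
      by (intro vec.dim_image_eq) (auto intro: inj_on_subset)
    moreover have "(*v) (transpose A) ` cart_basis = rows A"
      unfolding rows cart_basis_def Setcompr_eq_image image_image
      by (simp only: matrix_vector_mult_axis column_transpose)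
    moreover have "vec.dim (cart_basis :: ('a^'m) set) = CARD('m)"
      by (simp add: vec.dim_eq_card_independent independent_cart_basis card_cart_basis)
    ultimately show "rank A = CARD('m)"
      by (simp add: row_rank_def_gen)
  qed
  then show ?thesis
    by (simp add: matrix_right_invertible_independent_rows[symmetric]
        matrix_right_invertible_span_columns)
qed

lemma reachable_iff_span:
  "reachable A B \<longleftrightarrow> vec.span (\<Union>k<CARD('n). columns (mat_pow A k ** B)) = UNIV"
  for A :: "'a::field^'n^'n" and B :: "'a^'m^'n"
  by (simp add: reachable_def full_row_rank_iff_span_columns columns_reachability_matrix)

text \<open>The reachability matrix of a single-input pair as a square matrix, so that it has a
  determinant. The order of its columns is immaterial; the enumeration of the index type is the one
  used for \<^const>\<open>reachability_matrix\<close>.\<close>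

definition krylov_matrix :: "'a::comm_ring_1^'n^'n \<Rightarrow> 'a^'n \<Rightarrow> 'a^'n^'n" where
  "krylov_matrix A b = (\<chi> i j. (mat_pow A (to_nat_on (UNIV :: 'n set) j) *v b) $ i)"

lemma columns_krylov_matrix:
  "columns (krylov_matrix A b) = (\<lambda>k. mat_pow A k *v b) ` {..<CARD('n)}"
  for A :: "'a::field^'n^'n"
proof -
  have "to_nat_on (UNIV :: 'n set) ` UNIV = {..<CARD('n)}"
    using to_nat_on_finite[of "UNIV :: 'n set"] by (simp add: bij_betw_def)
  moreover have "columns (krylov_matrix A b) =
      (\<lambda>k. mat_pow A k *v b) ` (to_nat_on (UNIV :: 'n set) ` UNIV)"
    by (auto simp: columns_def column_def krylov_matrix_def image_iff)
  ultimately show ?thesis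
    by (simp only:)
qed

lemma reachable_columnvector_iff_det:
  "reachable A (columnvector b :: 'a^1^'n) \<longleftrightarrow> det (krylov_matrix A b) \<noteq> 0"
  for A :: "'a::field^'n^'n"
proof -
  have "columns (C ** (columnvector b :: 'a^1^'n)) = {C *v b}" for C :: "'a^'n^'n"
    by (simp add: columns_def column_def flip: dot_rowvector_columnvector)
      (simp add: columnvector_def)
  then have "(\<Union>k<CARD('n). columns (mat_pow A k ** (columnvector b :: 'a^1^'n))) =
      columns (krylov_matrix A b)"
    by (auto simp: columns_krylov_matrix)
  then show ?thesis
    by (simp add: reachable_iff_span invertible_det_nz[symmetric] invertible_right_inverse
        matrix_right_invertible_span_columns)
qed

section \<open>Heymann's lemma\<close>

text \<open>The form in which reachability enters Heymann's lemma: the span of the columns of all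
  \<open>A^k B\<close> lies in every \<open>A\<close>-invariant subspace that contains the range of \<open>B\<close>.\<close>

lemma reachable_invariant_subspace_eq_UNIV:
  fixes A :: "'a::field^'n^'n" and B :: "'a^'m^'n"
  assumes "reachable A B" "vec.subspace S" "\<And>u. B *v u \<in> S" "\<And>x. x \<in> S \<Longrightarrow> A *v x \<in> S"
  shows "S = UNIV"
proof -
  have "mat_pow A k *v (B *v u) \<in> S" for k u
    by (induction k) (auto simp: assms matrix_vector_mul_assoc[symmetric])
  moreover have "column i (mat_pow A k ** B) = mat_pow A k *v (B *v axis i 1)" for i k
    by (simp only: matrix_vector_mul_assoc) (simp only: matrix_vector_mult_axis)
  ultimately have "columns (mat_pow A k ** B) \<subseteq> S" for k
    by (auto simp: columns_def)
  then have "vec.span (\<Union>k<CARD('n). columns (mat_pow A k ** B)) \<subseteq> S"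
    by (intro vec.span_minimal assms(2)) auto
  then show ?thesis
    using assms(1) by (auto simp: reachable_iff_span)
qed

lemma independent_if_not_in_span_predecessors:
  fixes x :: "nat \<Rightarrow> 'a::field^'n"
  assumes "\<And>i. i < k \<Longrightarrow> x i \<notin> vec.span (x ` {..<i})"
  shows "vec.independent (x ` {..<k}) \<and> inj_on x {..<k}"
  using assms
proof (induction k)
  case 0
  then show ?case by (simp add: vec.independent_empty)
next
  case (Suc k)
  then have IH: "vec.independent (x ` {..<k})" "inj_on x {..<k}"
    by auto
  have "x k \<notin> vec.span (x ` {..<k})"
    using Suc.prems by simp
  then have "x k \<notin> x ` {..<k}" "vec.independent (insert (x k) (x ` {..<k}))"
    using vec.span_base[of "x k" "x ` {..<k}"] vec.independent_insertI[OF _ IH(1)] by metis+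
  then show ?case
    using IH(2) by (auto simp: lessThan_Suc)
qed

text \<open>If no control \<open>w\<close> leads from the last state out of the span \<open>S\<close> of the states so far, then
  comparing \<open>w\<close> with the zero control shows that \<open>S\<close> contains the range of \<open>B\<close>. Hence \<open>S\<close> is
  \<open>A\<close>-invariant, because \<open>A\<close> maps each earlier state to its successor up to an element of
  that range. By reachability \<open>S\<close> is then the whole space, although it is spanned by
  fewer than \<open>CARD('n)\<close> states.\<close>

lemma independent_trajectory_exists:
  fixes A :: "'a::field^'n^'n" and B :: "'a^'m^'n"
  assumes reach: "reachable A B" and "b \<noteq> 0" "0 < k" "k \<le> CARD('n)"
  shows "\<exists>x u. x 0 = b \<and> (\<forall>i. Suc i < k \<longrightarrow> x (Suc i) = A *v x i + B *v u i) \<and>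
    (\<forall>i<k. x i \<notin> vec.span (x ` {..<i}))"
  using assms(3,4)
proof (induction k rule: nat_induct_non_zero)
  case 1
  then show ?case
    using \<open>b \<noteq> 0\<close> by (intro exI[of _ "\<lambda>_. b"]) simp
next
  case (Suc k)
  then obtain x u where x0: "x 0 = b"
    and step: "\<And>i. Suc i < k \<Longrightarrow> x (Suc i) = A *v x i + B *v u i"
    and indep: "\<And>i. i < k \<Longrightarrow> x i \<notin> vec.span (x ` {..<i})"
    by auto
  define S where "S = vec.span (x ` {..<k})"
  have "vec.dim S \<le> card (x ` {..<k})"
    unfolding S_def by (intro vec.dim_le_card) auto
  also have "\<dots> \<le> k"
    using card_image_le[of "{..<k}" x] by simp
  also have "\<dots> < CARD('n)"
    using Suc.prems by simp
  finally have "S \<noteq> UNIV"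
    using vec_dim_card[where 'a='a and 'n='n] by auto
  have sub: "vec.subspace S"
    by (simp add: S_def)
  have x_in: "x i \<in> S" if "i < k" for i
    unfolding S_def using that by (intro vec.span_base) auto
  have "\<exists>w. A *v x (k - 1) + B *v w \<notin> S"
  proof (rule ccontr)
    assume "\<not> ?thesis"
    then have all: "A *v x (k - 1) + B *v w \<in> S" for w
      by blast
    have last: "A *v x (k - 1) \<in> S"
      using all[of 0] by simp
    have B_in: "B *v w \<in> S" for w
      using vec.subspace_diff[OF sub all[of w] last] by simp
    have A_gen: "A *v x i \<in> S" if "i < k" for i
    proof (cases "Suc i < k")
      case True
      then show ?thesis
        using vec.subspace_diff[OF sub x_in[OF True] B_in[of "u i"]] step[OF True] by simp
    next
      case False
      then have "i = k - 1"
        using that by simp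
      then show ?thesis
        using last by simp
    qed
    have "vec.subspace {y. A *v y \<in> S}"
      using sub by (auto simp: vec.subspace_def matrix_vector_right_distrib vector_scalar_commute)
    then have "S \<subseteq> {y. A *v y \<in> S}"
      using vec.span_minimal[of "x ` {..<k}" "{y. A *v y \<in> S}"] A_gen
      by (auto simp: S_def)
    then have "S = UNIV"
      by (intro reachable_invariant_subspace_eq_UNIV[OF reach sub B_in]) auto
    with \<open>S \<noteq> UNIV\<close> show False ..
  qed
  then obtain w where w: "A *v x (k - 1) + B *v w \<notin> S" ..
  define x' where "x' = x(k := A *v x (k - 1) + B *v w)"
  define u' where "u' = u(k - 1 := w)"
  have "x' ` {..<i} = x ` {..<i}" if "i \<le> k" for i
    using that by (auto simp: x'_def)
  then have "x' i \<notin> vec.span (x' ` {..<i})" if "i < Suc k" for i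
    using that indep[of i] w by (cases "i = k") (auto simp: x'_def S_def)
  moreover have "x' (Suc i) = A *v x' i + B *v u' i" if "Suc i < Suc k" for i
    using that step[of i] by (cases "Suc i = k") (auto simp: x'_def u'_def)
  moreover have "x' 0 = b"
    using x0 Suc.hyps by (simp add: x'_def)
  ultimately show ?case
    by blast
qed

text \<open>A trajectory of \<open>CARD('n)\<close> independent states is a basis, so some linear map \<open>K\<close> sends each
  state to the control applied there. With this feedback the powers of \<open>A + B K\<close> reproduce
  the trajectory from \<open>b\<close>.\<close>

lemma heymann:
  fixes A :: "'a::field^'n^'n" and B :: "'a^'m^'n"
  assumes "reachable A B" "b \<noteq> 0"
  shows "\<exists>K. det (krylov_matrix (A + B ** K) b) \<noteq> 0"
proof -
  obtain x u where x0: "x 0 = b"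
    and step: "\<And>i. Suc i < CARD('n) \<Longrightarrow> x (Suc i) = A *v x i + B *v u i"
    and "\<And>i. i < CARD('n) \<Longrightarrow> x i \<notin> vec.span (x ` {..<i})"
    using independent_trajectory_exists[OF assms, of "CARD('n)"] by auto
  then have indep: "vec.independent (x ` {..<CARD('n)})" and inj: "inj_on x {..<CARD('n)}"
    using independent_if_not_in_span_predecessors by blast+
  obtain f where lin: "Vector_Spaces.linear (*s) (*s) f"
    and f: "\<And>y. y \<in> x ` {..<CARD('n)} \<Longrightarrow> f y = u (the_inv_into {..<CARD('n)} x y)"
    using vec.linear_independent_extend[OF indep, of "\<lambda>y. u (the_inv_into {..<CARD('n)} x y)"]
    by auto
  define K where "K = matrix f"
  have K: "K *v x i = u i" if "i < CARD('n)" for i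
    using that f[of "x i"] by (simp add: K_def matrix_works[OF lin] the_inv_into_f_f[OF inj])
  have "mat_pow (A + B ** K) i *v b = x i" if "i < CARD('n)" for i
    using that
  proof (induction i)
    case 0
    then show ?case by (simp add: x0)
  next
    case (Suc i)
    then show ?case
      by (simp add: matrix_vector_mul_assoc[symmetric] matrix_vector_mult_add_rdistrib K step)
  qed
  then have "columns (krylov_matrix (A + B ** K) b) = x ` {..<CARD('n)}"
    by (auto simp: columns_krylov_matrix)
  moreover have "vec.span (x ` {..<CARD('n)}) = UNIV"
    using vec.card_ge_dim_independent[OF subset_UNIV indep]
    by (auto simp: card_image[OF inj] card_cart_basis)
  ultimately have "det (krylov_matrix (A + B ** K) b) \<noteq> 0"
    by (simp add: invertible_det_nz[symmetric] invertible_right_inverse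
        matrix_right_invertible_span_columns)
  then show ?thesis ..
qed

section \<open>Continuous sections with path-connected fibres\<close>

text \<open>\<open>U\<close> is thought of as a family of fibres over the real line; two points of the
  total space are linked if a section of \<open>U\<close> over the interval between them joins them.\<close>

definition linked :: "(real \<times> 'b::topological_space) set \<Rightarrow> real \<Rightarrow> 'b \<Rightarrow> real \<Rightarrow> 'b \<Rightarrow> bool" where
  "linked U s k t l \<longleftrightarrow> (\<exists>f. continuous_on {s..t} f \<and> f s = k \<and> f t = l \<and>
    (\<forall>\<tau>\<in>{s..t}. (\<tau>, f \<tau>) \<in> U))"

lemma linked_trans:
  assumes "linked U r j s k" "linked U s k t l" "r \<le> s" "s \<le> t"
  shows "linked U r j t l"
proof -
  obtain f where f: "continuous_on {r..s} f" "f r = j" "f s = k" "\<forall>\<tau>\<in>{r..s}. (\<tau>, f \<tau>) \<in> U"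
    using assms(1) by (auto simp: linked_def)
  obtain g where g: "continuous_on {s..t} g" "g s = k" "g t = l" "\<forall>\<tau>\<in>{s..t}. (\<tau>, g \<tau>) \<in> U"
    using assms(2) by (auto simp: linked_def)
  define h where "h = (\<lambda>\<tau>. if \<tau> \<le> s then f \<tau> else g \<tau>)"
  have "{\<tau> \<in> {r..t}. \<tau> \<le> s} = {r..s}" "{\<tau> \<in> {r..t}. s \<le> \<tau>} = {s..t}"
    using assms(3,4) by auto
  then have "continuous_on {r..t} h"
    unfolding h_def using f g by (intro continuous_on_cases_1) auto
  moreover have "h r = j" "h t = l"
    using f g assms(3,4) by (auto simp: h_def)
  moreover have "\<forall>\<tau>\<in>{r..t}. (\<tau>, h \<tau>) \<in> U"
    using f g by (auto simp: h_def)
  ultimately show ?thesis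
    unfolding linked_def by blast
qed

text \<open>A path inside the fibre over \<open>x\<close> is compact, so by the tube lemma it lies in all fibres over a
  neighbourhood of \<open>x\<close>. Run over any short interval in that neighbourhood, it is a section.\<close>

lemma linked_near_fibre:
  fixes U :: "(real \<times> 'b::topological_space) set"
  assumes "open U" and "path_connected {k. (x, k) \<in> U}" and "(x, k) \<in> U" "(x, l) \<in> U"
  shows "\<exists>d>0. \<forall>s t. s < t \<and> {s..t} \<subseteq> ball x d \<longrightarrow> linked U s k t l"
proof -
  obtain p where p: "path p" "path_image p \<subseteq> {k. (x, k) \<in> U}" "pathstart p = k" "pathfinish p = l"
    using assms(2-) unfolding path_connected_def by blast
  have "{x} \<times> path_image p \<subseteq> U"
    using p(2) by auto
  then obtain X where X: "x \<in> X" "open X" "X \<times> path_image p \<subseteq> U"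
    using Elementary_Topology.tube_lemma[OF compact_path_image[OF p(1)] \<open>open U\<close>] by metis
  then obtain d where d: "0 < d" "ball x d \<subseteq> X"
    using open_contains_ball by blast
  have "linked U s k t l" if st: "s < t" "{s..t} \<subseteq> ball x d" for s t
  proof -
    define f where "f = (\<lambda>\<tau>. p ((\<tau> - s) / (t - s)))"
    have param: "(\<tau> - s) / (t - s) \<in> {0..1}" if "\<tau> \<in> {s..t}" for \<tau>
      using that st(1) by (auto simp: divide_simps)
    have "continuous_on {s..t} f"
      unfolding f_def using st(1) param
      by (intro continuous_on_compose2[OF p(1)[unfolded path_def]] continuous_intros) auto
    moreover have "(\<tau>, f \<tau>) \<in> U" if "\<tau> \<in> {s..t}" for \<tau>
    proof -
      have "f \<tau> \<in> path_image p"
        unfolding f_def path_image_def using param[OF that] by blast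
      then show ?thesis
        using that st(2) d(2) X(3) by blast
    qed
    moreover have "f s = k" "f t = l"
      using p(3,4) st(1) by (auto simp: f_def pathstart_def pathfinish_def)
    ultimately show ?thesis
      unfolding linked_def by blast
  qed
  then show ?thesis
    using d(1) by blast
qed

text \<open>Bisection reduces the claim to short intervals \<open>{s..t}\<close> around a point \<open>x\<close>. There a point \<open>m\<close>
  of the fibre over \<open>x\<close> belongs to all fibres over the interval, and the section moves from \<open>k\<close> to \<open>m\<close>
  just after \<open>s\<close>, rests at \<open>m\<close>, and moves from \<open>m\<close> to \<open>l\<close> just before \<open>t\<close>.\<close>

lemma linked_if_path_connected_fibres:
  fixes U :: "(real \<times> 'b::topological_space) set"
  assumes "open U"
    and conn: "\<And>t. t \<in> {0..1} \<Longrightarrow> path_connected {k. (t, k) \<in> U}"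
    and ne: "\<And>t. t \<in> {0..1} \<Longrightarrow> \<exists>k. (t, k) \<in> U"
    and "(0, k0) \<in> U" "(1, k1) \<in> U"
  shows "linked U 0 k0 1 k1"
proof -
  define P where "P s t \<longleftrightarrow> (0 \<le> s \<and> s < t \<and> t \<le> 1 \<longrightarrow>
    (\<forall>k l. (s, k) \<in> U \<and> (t, l) \<in> U \<longrightarrow> linked U s k t l))" for s t
  \<comment> \<open>The strict inequality excludes one-point intervals, over which distinct points of the fibre
    cannot be linked; hence the degenerate case in the composition step.\<close>
  have "P 0 1"
  proof (induction rule: Bolzano[OF zero_le_one[where 'a=real], of P, case_names trans local])
    case (trans a b c)
    show ?case
      unfolding P_def
    proof (intro impI allI)
      fix k l assume ac: "0 \<le> a \<and> a < c \<and> c \<le> 1" and kl: "(a, k) \<in> U \<and> (c, l) \<in> U"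
      show "linked U a k c l"
      proof (cases "a = b \<or> b = c")
        case True
        then show ?thesis
          using trans(1,2) ac kl by (auto simp: P_def)
      next
        case False
        obtain m where "(b, m) \<in> U"
          using ne[of b] ac trans(3,4) by auto
        then show ?thesis
          using False trans ac kl linked_trans[of U a k b m c l] by (auto simp: P_def)
      qed
    qed
  next
    case (local x)
    then obtain m where "(x, m) \<in> U"
      using ne[of x] by auto
    then obtain X Y where XY: "open X" "x \<in> X" "m \<in> Y" "X \<times> Y \<subseteq> U"
      using \<open>open U\<close> unfolding open_prod_def by (metis mem_Sigma_iff)
    then obtain d where d: "0 < d" "ball x d \<subseteq> X"
      using open_contains_ball by blast
    then have m: "(\<tau>, m) \<in> U" if "\<bar>\<tau> - x\<bar> < d" for \<tau>
      using that XY by (auto simp: dist_real_def subset_iff abs_minus_commute)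
    have "P s t" if st: "s \<le> x" "x \<le> t" "t - s < d" for s t
      unfolding P_def
    proof (intro impI allI)
      fix k l assume b: "0 \<le> s \<and> s < t \<and> t \<le> 1" and kl: "(s, k) \<in> U \<and> (t, l) \<in> U"
      have mU: "(\<tau>, m) \<in> U" if "\<tau> \<in> {s..t}" for \<tau>
        using that st by (intro m) auto
      obtain d1 where d1: "0 < d1"
        and l1: "\<And>q r. q < r \<Longrightarrow> {q..r} \<subseteq> ball s d1 \<Longrightarrow> linked U q k r m"
        using linked_near_fibre[OF \<open>open U\<close> conn, of s k m] b kl mU[of s] by auto
      obtain d2 where d2: "0 < d2"
        and l2: "\<And>q r. q < r \<Longrightarrow> {q..r} \<subseteq> ball t d2 \<Longrightarrow> linked U q m r l"
        using linked_near_fibre[OF \<open>open U\<close> conn, of t m l] b kl mU[of t] by auto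
      define e where "e = min (min d1 d2) (t - s) / 3"
      have e: "0 < e" "e < d1" "e < d2" "s + e \<le> t - e"
        using d1 d2 b by (auto simp: e_def min_def field_simps)
      have "linked U s k (s + e) m"
        using e by (intro l1) (auto simp: dist_real_def)
      moreover have "linked U (s + e) m (t - e) m"
        unfolding linked_def using e mU by (intro exI[of _ "\<lambda>_. m"]) auto
      moreover have "linked U (t - e) m t l"
        using e by (intro l2) (auto simp: dist_real_def)
      ultimately show "linked U s k t l"
        using linked_trans e by (smt (verit))
    qed
    then show ?case
      using d(1) by blast
  qed
  then show ?thesis
    using assms(4,5) by (auto simp: P_def)
qed

text \<open>A one-point interval has to be split off because it is not the image of a simple path. All other
  cases are treated alike: the path is allowed to be closed.\<close>

lemma interval_or_circle_cases:
  assumes "interval_or_circle P"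
  obtains a where "P = {a}"
  | \<gamma> where "simple_path \<gamma>" "path_image \<gamma> = P"
proof -
  have simple: "\<exists>\<gamma>. simple_path \<gamma> \<and> path_image \<gamma> = P"
    if \<delta>: "simple_path \<delta>" and hom: "P homeomorphic path_image \<delta>" for \<delta> :: "real \<Rightarrow> 'x::t2_space"
  proof -
    obtain h where h: "continuous_on (path_image \<delta>) h" "h ` path_image \<delta> = P"
        "inj_on h (path_image \<delta>)"
      using hom unfolding homeomorphic_sym[of P] homeomorphic_def homeomorphism_def
      by (metis inj_on_inverseI)
    have "loop_free (h \<circ> \<delta>)"
      unfolding loop_free_def
    proof (intro ballI impI)
      fix s t :: real assume st: "s \<in> {0..1}" "t \<in> {0..1}" "(h \<circ> \<delta>) s = (h \<circ> \<delta>) t"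
      then have "\<delta> s = \<delta> t"
        using h(3) by (auto simp: path_image_def inj_on_def)
      then show "s = t \<or> s = 0 \<and> t = 1 \<or> s = 1 \<and> t = 0"
        using \<delta> st(1,2) by (auto simp: simple_path_def loop_free_def)
    qed
    then have "simple_path (h \<circ> \<delta>)" "path_image (h \<circ> \<delta>) = P"
      using \<delta> h by (auto simp: simple_path_def path_image_compose intro: path_continuous_image)
    then show ?thesis
      by blast
  qed
  show ?thesis
    using assms unfolding interval_or_circle_def
  proof (elim disjE exE conjE)
    fix a b :: real assume ab: "a \<le> b" and hom: "P homeomorphic {a..b}"
    show ?thesis
    proof (cases "a = b")
      case True
      then have "P homeomorphic {a}"
        using hom by simp
      then show ?thesis
        using that(1) by (auto simp: homeomorphic_def homeomorphism_def)
    next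
      case False
      then have "simple_path (linepath a b)"
        by (simp add: arc_imp_simple_path)
      moreover have "path_image (linepath a b) = {a..b}"
        using ab by (simp add: closed_segment_eq_real_ivl)
      ultimately show ?thesis
        using simple[of "linepath a b"] hom that(2) by auto
    qed
  next
    fix c :: complex and r :: real assume "0 < r" "P homeomorphic sphere c r"
    then show ?thesis
      using simple[of "circlepath c r"] that(2) by (auto simp: simple_path_circlepath)
  qed
qed

text \<open>A simple path identifies at most its two ends, and it is a quotient map onto its image by
  compactness.\<close>

lemma continuous_on_descends_along_simple_path:
  fixes \<gamma> :: "real \<Rightarrow> 'b::t2_space" and f :: "real \<Rightarrow> 'c::topological_space"
  assumes \<gamma>: "simple_path \<gamma>" and f: "continuous_on {0..1} f"
    and loop: "pathstart \<gamma> = pathfinish \<gamma> \<Longrightarrow> f 0 = f 1"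
  obtains g where "continuous_on (path_image \<gamma>) g" "\<And>t. t \<in> {0..1} \<Longrightarrow> g (\<gamma> t) = f t"
proof -
  have "\<exists>g. \<forall>t\<in>{0..1}. g (\<gamma> t) = f t"
  proof -
    have "f s = f t" if st: "s \<in> {0..1}" "t \<in> {0..1}" "\<gamma> s = \<gamma> t" for s t
    proof -
      have "s = t \<or> s = 0 \<and> t = 1 \<or> s = 1 \<and> t = 0"
        using \<gamma> st by (simp add: simple_path_def loop_free_def)
      then show ?thesis
        using loop st(3) by (auto simp: pathstart_def pathfinish_def)
    qed
    then have "f (inv_into {0..1} \<gamma> (\<gamma> t)) = f t" if "t \<in> {0..1}" for t
      using that by (metis f_inv_into_f imageI inv_into_into)
    then show ?thesis
      by (intro exI[of _ "\<lambda>p. f (inv_into {0..1} \<gamma> p)"]) auto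
  qed
  then obtain g where g: "\<And>t. t \<in> {0..1} \<Longrightarrow> g (\<gamma> t) = f t"
    by blast
  have \<gamma>_cont: "continuous_on {0..1} \<gamma>"
    using \<gamma> by (simp add: simple_path_def path_def)
  have "openin (top_of_set (path_image \<gamma>)) (path_image \<gamma> \<inter> g -` V)" if "open V" for V
  proof -
    have "\<gamma> t \<in> path_image \<gamma>" if "t \<in> {0..1}" for t
      using that by (simp add: path_image_def)
    then have "{0..1} \<inter> \<gamma> -` (path_image \<gamma> \<inter> g -` V) = {0..1} \<inter> f -` V"
      using g by auto
    moreover have "openin (top_of_set {0..1}) ({0..1} \<inter> f -` V)"
      using f that by (rule continuous_openin_preimage_gen)
    ultimately show ?thesis
      using Abstract_Topology_2.continuous_imp_quotient_map[OF \<gamma>_cont refl compact_Icc,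
        of "path_image \<gamma> \<inter> g -` V"]
      by (auto simp: path_image_def)
  qed
  then have "continuous_on (path_image \<gamma>) g"
    by (simp add: continuous_on_open_invariant openin_open Int_commute) metis
  then show ?thesis
    using that g by blast
qed

text \<open>The family is pulled back to the unit interval along a parametrisation of \<open>P\<close>, where the end
  values of the section may be prescribed. If the parametrisation is closed they are chosen equal,
  so that the section descends to \<open>P\<close>.\<close>

lemma continuous_section_exists:
  fixes P :: "complex set" and \<phi> :: "complex \<Rightarrow> 'k::topological_space \<Rightarrow> complex"
  assumes P: "interval_or_circle P"
    and cont: "continuous_on (P \<times> UNIV) (\<lambda>(\<theta>, k). \<phi> \<theta> k)"
    and ne: "\<And>\<theta>. \<theta> \<in> P \<Longrightarrow> \<exists>k. \<phi> \<theta> k \<noteq> 0"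
    and conn: "\<And>\<theta>. \<theta> \<in> P \<Longrightarrow> path_connected {k. \<phi> \<theta> k \<noteq> 0}"
  obtains K where "continuous_on P K" "\<And>\<theta>. \<theta> \<in> P \<Longrightarrow> \<phi> \<theta> (K \<theta>) \<noteq> 0"
  using P
proof (cases rule: interval_or_circle_cases)
  case (1 a)
  then obtain k where "\<phi> a k \<noteq> 0"
    using ne by auto
  then show ?thesis
    using that[of "\<lambda>_. k"] 1 by auto
next
  case (2 \<gamma>)
  have \<gamma>: "continuous_on {0..1} \<gamma>"
    using 2 by (simp add: simple_path_def path_def)
  have \<gamma>_in: "\<gamma> t \<in> P" if "t \<in> {0..1}" for t
    using 2 that by (auto simp: path_image_def)
  have "continuous_on ({0..1} \<times> UNIV) (\<lambda>x. \<phi> (\<gamma> (fst x)) (snd x))"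
    by (rule continuous_on_compose2[OF cont, of _ "\<lambda>x. (\<gamma> (fst x), snd x)", simplified])
      (use \<gamma>_in in \<open>auto intro!: continuous_intros continuous_on_compose2[OF \<gamma>]\<close>)
  then have "openin (top_of_set ({0..1} \<times> UNIV))
      (({0..1} \<times> UNIV) \<inter> (\<lambda>x. \<phi> (\<gamma> (fst x)) (snd x)) -` (- {0}))"
    by (rule continuous_openin_preimage_gen) auto
  then obtain U where "open U"
    and "({0..1} \<times> UNIV) \<inter> (\<lambda>x. \<phi> (\<gamma> (fst x)) (snd x)) -` (- {0}) = ({0..1} \<times> UNIV) \<inter> U"
    unfolding openin_open by blast
  then have U: "(t, k) \<in> U \<longleftrightarrow> \<phi> (\<gamma> t) k \<noteq> 0" if "t \<in> {0..1}" for t k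
    using that by (auto simp: set_eq_iff)
  obtain k0 where k0: "\<phi> (\<gamma> 0) k0 \<noteq> 0"
    using ne[OF \<gamma>_in] by force
  obtain k1 where k1: "\<phi> (\<gamma> 1) k1 \<noteq> 0" "\<gamma> 0 = \<gamma> 1 \<Longrightarrow> k0 = k1"
    using ne[OF \<gamma>_in, of 1] k0 by (cases "\<gamma> 0 = \<gamma> 1") auto
  have "linked U 0 k0 1 k1"
    by (rule linked_if_path_connected_fibres[OF \<open>open U\<close>])
      (use U conn ne \<gamma>_in k0 k1 in auto)
  then obtain f where f: "continuous_on {0..1} f" "f 0 = k0" "f 1 = k1"
      "\<And>t. t \<in> {0..1} \<Longrightarrow> \<phi> (\<gamma> t) (f t) \<noteq> 0"
    using U unfolding linked_def by blast
  have "pathstart \<gamma> = pathfinish \<gamma> \<Longrightarrow> f 0 = f 1"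
    using k1(2) f(2,3) by (simp add: pathstart_def pathfinish_def)
  then obtain K where K: "continuous_on P K" "\<And>t. t \<in> {0..1} \<Longrightarrow> K (\<gamma> t) = f t"
    using continuous_on_descends_along_simple_path[OF 2(1) f(1)] 2(2) by metis
  have "\<phi> \<theta> (K \<theta>) \<noteq> 0" if "\<theta> \<in> P" for \<theta>
    using that K(2) f(4) 2(2) by (auto simp: path_image_def)
  then show ?thesis
    using that K(1) by blast
qed

section \<open>Path-connectedness of the set of good gains\<close>

text \<open>The polynomial \<open>p\<close> is nonzero because it does not vanish at \<open>0\<close>, so two points of the
  set are joined within the image under \<open>l\<close> of the plane without the finitely many roots of \<open>p\<close>.\<close>

lemma path_connected_if_polynomial_on_lines:
  fixes \<phi> :: "'k::topological_space \<Rightarrow> complex"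
  assumes "\<And>x y. \<phi> x \<noteq> 0 \<Longrightarrow> \<phi> y \<noteq> 0 \<Longrightarrow>
    \<exists>l p. continuous_on UNIV l \<and> l 0 = x \<and> l 1 = y \<and> (\<forall>z. \<phi> (l z) = poly p z)"
  shows "path_connected {x. \<phi> x \<noteq> 0}"
  unfolding path_connected_component
proof (intro ballI)
  fix x y assume xy: "x \<in> {x. \<phi> x \<noteq> 0}" "y \<in> {x. \<phi> x \<noteq> 0}"
  then obtain l p where l: "continuous_on UNIV l" "l 0 = x" "l 1 = y"
    and p: "\<And>z. \<phi> (l z) = poly p z"
    using assms by force
  have "p \<noteq> 0"
    using xy(1) l(2) p[of 0] by auto
  then have "path_connected (- {z. poly p z = 0})"
    by (intro path_connected_complement_countable countable_finite poly_roots_finite) auto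
  then have "path_connected (l ` (- {z. poly p z = 0}))"
    using l(1) by (intro path_connected_continuous_image) (auto intro: continuous_on_subset)
  moreover have "x \<in> l ` (- {z. poly p z = 0})" "y \<in> l ` (- {z. poly p z = 0})"
    using xy l p by (metis (mono_tags) ComplI image_eqI mem_Collect_eq)+
  ultimately have "path_component (l ` (- {z. poly p z = 0})) x y"
    unfolding path_connected_component by blast
  then show "path_component {x. \<phi> x \<noteq> 0} x y"
    by (rule path_component_of_subset[rotated]) (auto simp: p)
qed

text \<open>That the determinant is a polynomial in the line parameter is seen by forming the
  same determinant over the polynomial ring, with the indeterminate as parameter: evaluation at \<open>z\<close>
  is a ring homomorphism and so commutes with all matrix operations involved.\<close>

abbreviation eval_matrix :: "'a::comm_ring_1 \<Rightarrow> 'a poly^'n^'m \<Rightarrow> 'a^'n^'m" where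
  "eval_matrix z \<equiv> map_matrix (\<lambda>p. poly p z)"

abbreviation const_matrix :: "'a::comm_ring_1^'n^'m \<Rightarrow> 'a poly^'n^'m" where
  "const_matrix \<equiv> map_matrix (\<lambda>c. [:c:])"

lemma eval_matrix_mult: "eval_matrix z (M ** N) = eval_matrix z M ** eval_matrix z N"
  by (simp add: vec_eq_iff matrix_matrix_mult_def poly_sum)

lemma eval_matrix_add: "eval_matrix z (M + N) = eval_matrix z M + eval_matrix z N"
  by (simp add: vec_eq_iff)

lemma eval_matrix_mat: "eval_matrix z (mat p) = mat (poly p z)"
  by (simp add: vec_eq_iff mat_def)

lemma eval_const_matrix: "eval_matrix z (const_matrix M) = M"
  by (simp add: vec_eq_iff)

lemma eval_matrix_mat_pow: "eval_matrix z (mat_pow M k) = mat_pow (eval_matrix z M) k"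
  by (induction k) (simp_all add: eval_matrix_mult eval_matrix_mat)

lemma det_eval_matrix: "det (eval_matrix z M) = poly (det M) z"
  by (simp add: det_def poly_sum poly_prod)

lemma eval_krylov_matrix:
  "eval_matrix z (krylov_matrix M (\<chi> i. [:b $ i:])) = krylov_matrix (eval_matrix z M) b"
  by (simp add: vec_eq_iff krylov_matrix_def matrix_vector_mult_def poly_sum mult.commute
      flip: eval_matrix_mat_pow)

lemma det_krylov_matrix_polynomial_on_lines:
  fixes A :: "'a::comm_ring_1^'n^'n" and B :: "'a^'m^'n"
  shows "\<exists>p. \<forall>z. det (krylov_matrix (A + B ** (K + mat z ** D)) b) = poly p z"
proof
  let ?M = "const_matrix A + const_matrix B ** (const_matrix K + mat [:0, 1:] ** const_matrix D)"
  show "\<forall>z. det (krylov_matrix (A + B ** (K + mat z ** D)) b) =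
      poly (det (krylov_matrix ?M (\<chi> i. [:b $ i:]))) z"
    by (simp only: det_eval_matrix[symmetric] eval_krylov_matrix eval_matrix_add eval_matrix_mult
        eval_const_matrix eval_matrix_mat) simp
qed

lemma continuous_on_matrix_mult [continuous_intros]:
  fixes F :: "'t::topological_space \<Rightarrow> 'a::real_normed_algebra_1^'m^'n" and G :: "'t \<Rightarrow> 'a^'k^'m"
  assumes "continuous_on S F" "continuous_on S G"
  shows "continuous_on S (\<lambda>t. F t ** G t)"
  unfolding matrix_matrix_mult_def by (intro continuous_intros assms)

lemma continuous_on_matrix_vector_mult [continuous_intros]:
  fixes F :: "'t::topological_space \<Rightarrow> 'a::real_normed_algebra_1^'m^'n" and x :: "'t \<Rightarrow> 'a^'m"
  assumes "continuous_on S F" "continuous_on S x"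
  shows "continuous_on S (\<lambda>t. F t *v x t)"
  unfolding matrix_vector_mult_def by (intro continuous_intros assms)

lemma continuous_on_mat_pow [continuous_intros]:
  fixes F :: "'t::topological_space \<Rightarrow> 'a::real_normed_algebra_1^'n^'n"
  assumes "continuous_on S F"
  shows "continuous_on S (\<lambda>t. mat_pow (F t) k)"
  by (induction k) (auto intro!: continuous_intros assms)

lemma continuous_on_det_krylov_matrix [continuous_intros]:
  fixes F :: "'t::topological_space \<Rightarrow> 'a::real_normed_field^'n^'n"
  assumes "continuous_on S F" "continuous_on S x"
  shows "continuous_on S (\<lambda>t. det (krylov_matrix (F t) (x t)))"
  unfolding det_def krylov_matrix_def by (intro continuous_intros assms)

lemma continuous_on_mat [continuous_intros]:
  fixes f :: "'t::topological_space \<Rightarrow> 'a::real_normed_algebra_1"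
  assumes "continuous_on S f"
  shows "continuous_on S (\<lambda>t. mat (f t) :: 'a^'n^'n)"
proof -
  have "continuous_on S (\<lambda>t. if i = j then f t else 0)" for i j :: 'n
    using assms by (cases "i = j") auto
  then show ?thesis
    unfolding mat_def by (intro continuous_intros)
qed

lemma path_connected_cyclic_gains:
  fixes A :: "complex^'n^'n" and B :: "complex^'m^'n"
  shows "path_connected {K. det (krylov_matrix (A + B ** K) b) \<noteq> 0}"
proof (rule path_connected_if_polynomial_on_lines)
  fix K L :: "complex^'n^'m"
  have "continuous_on UNIV (\<lambda>z. K + mat z ** (L - K))"
    by (intro continuous_intros)
  moreover have "mat 0 ** (L - K) = 0"
    by (simp add: vec_eq_iff matrix_matrix_mult_def mat_def)
  ultimately show "\<exists>l p. continuous_on UNIV l \<and> l 0 = K \<and> l 1 = L \<and>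
      (\<forall>z. det (krylov_matrix (A + B ** l z) b) = poly p z)"
    using det_krylov_matrix_polynomial_on_lines[of A B K "L - K" b]
    by (intro exI[of _ "\<lambda>z. K + mat z ** (L - K)"]) auto
qed

section \<open>A continuous feedback\<close>

theorem lemma4p1:
  fixes P :: "complex set"
    and A :: "complex \<Rightarrow> complex^'n^'n"
    and B :: "complex \<Rightarrow> complex^'m^'n"
    and v :: "complex^'m"
  assumes "interval_or_circle P"
    and "continuous_on P A" and "continuous_on P B"
    and "pointwise_reachable P A B"
    and "\<forall>\<theta>\<in>P. B \<theta> *v v \<noteq> 0"
  shows "\<exists>K :: complex \<Rightarrow> complex^'n^'m. continuous_on P K \<and>
    pointwise_reachable P (\<lambda>\<theta>. A \<theta> + B \<theta> ** K \<theta>)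
      (\<lambda>\<theta>. columnvector (B \<theta> *v v) :: complex^1^'n)"
proof -
  have AB: "continuous_on (P \<times> (UNIV :: (complex^'n^'m) set)) (\<lambda>x. A (fst x))"
    "continuous_on (P \<times> (UNIV :: (complex^'n^'m) set)) (\<lambda>x. B (fst x))"
    by (auto intro!: continuous_on_compose2[OF assms(2)] continuous_on_compose2[OF assms(3)]
        continuous_intros)
  obtain K where "continuous_on P K"
    and "\<And>\<theta>. \<theta> \<in> P \<Longrightarrow> det (krylov_matrix (A \<theta> + B \<theta> ** K \<theta>) (B \<theta> *v v)) \<noteq> 0"
  proof (rule continuous_section_exists[OF assms(1),
        of "\<lambda>\<theta> K. det (krylov_matrix (A \<theta> + B \<theta> ** K) (B \<theta> *v v))"])
    show "continuous_on (P \<times> UNIV)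
        (\<lambda>(\<theta>, K). det (krylov_matrix (A \<theta> + B \<theta> ** K) (B \<theta> *v v)))"
      unfolding case_prod_unfold by (intro continuous_intros AB)
  next
    fix \<theta> assume "\<theta> \<in> P"
    then show "\<exists>K. det (krylov_matrix (A \<theta> + B \<theta> ** K) (B \<theta> *v v)) \<noteq> 0"
      using assms(4,5) by (intro heymann) (auto simp: pointwise_reachable_def)
  qed (use path_connected_cyclic_gains in auto)
  then show ?thesis
    unfolding pointwise_reachable_def reachable_columnvector_iff_det by blast
qed

end
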